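(* Let $\mathfrak A,\mathfrak Q$ be groups, let $\mathfrak A\wr\mathfrak Q=\mathfrak A^{\mathfrak Q}\rtimes\mathfrak Q$ be their wreath product, and let $\tau\colon\mathfrak A\wr\mathfrak Q\to\mathfrak Q$ be the natural projection. Call a subgroup $\mathfrak E\le\mathfrak A\wr\mathfrak Q$ admissible if $\tau(\mathfrak E)=\mathfrak Q$ and the evaluation map $\mathfrak A^{\mathfrak Q}\to\mathfrak A$, $f\mapsto f(1)$, restricts to an isomorphism $\mathfrak E\cap\mathfrak A^{\mathfrak Q}\to\mathfrak A$. To an admissible $\mathfrak E$ associate the extension $1\to\mathfrak A\to\mathfrak E\to\mathfrak Q\to1$ whose map $\mathfrak A\to\mathfrak E$ is the inverse of this isomorphism followed by inclusion, and whose map $\mathfrak E\to\mathfrak Q$ is $\tau|_{\mathfrak E}$. Then the correspondence $\mathfrak E\mapsto\mathfrak E$, sending an extension to the class of the admissible subgroups whose associated extension is equivalent to it, is a well-defined bijection from $$\{\text{group extensions } 1\to\mathfrak A\to\mathfrak E\to\mathfrak Q\to1\}\,/\,\text{equivalence of extensions}$$ to $$\{\text{admissible subgroups } \mathfrak E\le\mathfrak A\wr\mathfrak Q\}\,/\,\text{conjugation by elements } (f,1) \text{ with } f\in\mathfrak A^{\mathfrak Q},\ f(1)=1 .$$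
   Context: $\mathfrak A^{\mathfrak Q}$ is the group of all functions $\mathfrak Q\to\mathfrak A$ under pointwise multiplication, identified with $\ker\tau$; $\mathfrak Q$ acts on it by right translation, $(q\cdot f)(r)=f(rq)$, and $\mathfrak A\wr\mathfrak Q$ is the resulting semidirect product. An equivalence of two extensions of $\mathfrak A$ by $\mathfrak Q$ is a group isomorphism $\mathfrak E\to\mathfrak E'$ inducing the identity on $\mathfrak A$ and on $\mathfrak Q$. *)

theory Defs
  imports "HOL-Algebra.Product_Groups"
begin

definition semidirect_product ::
    "('n, 'm) monoid_scheme \<Rightarrow> ('h, 'k) monoid_scheme \<Rightarrow> ('h \<Rightarrow> 'n \<Rightarrow> 'n) \<Rightarrow> ('n \<times> 'h) monoid"
  where "semidirect_product N H \<phi> =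
    \<lparr>carrier = carrier N \<times> carrier H,
     monoid.mult = (\<lambda>(n, h) (n', h'). (n \<otimes>\<^bsub>N\<^esub> \<phi> h n', h \<otimes>\<^bsub>H\<^esub> h')),
     one = (\<one>\<^bsub>N\<^esub>, \<one>\<^bsub>H\<^esub>)\<rparr>"

abbreviation base_group ::
    "('a, 'm) monoid_scheme \<Rightarrow> ('q, 'k) monoid_scheme \<Rightarrow> ('q \<Rightarrow> 'a) monoid"
  where "base_group A Q \<equiv> product_group (carrier Q) (\<lambda>_. A)"

definition right_translation :: "('q, 'k) monoid_scheme \<Rightarrow> 'q \<Rightarrow> ('q \<Rightarrow> 'a) \<Rightarrow> 'q \<Rightarrow> 'a"
  where "right_translation Q q f = (\<lambda>r\<in>carrier Q. f (r \<otimes>\<^bsub>Q\<^esub> q))"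

definition wreath_product ::
    "('a, 'm) monoid_scheme \<Rightarrow> ('q, 'k) monoid_scheme \<Rightarrow> (('q \<Rightarrow> 'a) \<times> 'q) monoid"
  where "wreath_product A Q = semidirect_product (base_group A Q) Q (right_translation Q)"

text \<open>The function group is identified with the kernel of the projection \<open>\<tau> = snd\<close>, that is, with
  the set of all pairs \<open>(f, 1)\<close>.\<close>

definition wreath_base ::
    "('a, 'm) monoid_scheme \<Rightarrow> ('q, 'k) monoid_scheme \<Rightarrow> (('q \<Rightarrow> 'a) \<times> 'q) set"
  where "wreath_base A Q = kernel (wreath_product A Q) Q snd"

definition eval_at_one :: "('q, 'k) monoid_scheme \<Rightarrow> ('q \<Rightarrow> 'a) \<times> 'q \<Rightarrow> 'a"
  where "eval_at_one Q x = fst x \<one>\<^bsub>Q\<^esub>"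

definition admissible_subgroups ::
    "('a, 'm) monoid_scheme \<Rightarrow> ('q, 'k) monoid_scheme \<Rightarrow> (('q \<Rightarrow> 'a) \<times> 'q) set set"
  where "admissible_subgroups A Q =
    {E. subgroup E (wreath_product A Q) \<and> snd ` E = carrier Q \<and>
        eval_at_one Q \<in> iso (wreath_product A Q\<lparr>carrier := E \<inter> wreath_base A Q\<rparr>) A}"

definition base_conj_rel ::
    "('a, 'm) monoid_scheme \<Rightarrow> ('q, 'k) monoid_scheme \<Rightarrow>
     ((('q \<Rightarrow> 'a) \<times> 'q) set \<times> (('q \<Rightarrow> 'a) \<times> 'q) set) set"
  where "base_conj_rel A Q =
    {(E, E'). E \<in> admissible_subgroups A Q \<and> E' \<in> admissible_subgroups A Q \<and>
       (\<exists>f \<in> carrier (base_group A Q). f \<one>\<^bsub>Q\<^esub> = \<one>\<^bsub>A\<^esub> \<and>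
          E' = (\<lambda>x. (f, \<one>\<^bsub>Q\<^esub>) \<otimes>\<^bsub>wreath_product A Q\<^esub> x
                 \<otimes>\<^bsub>wreath_product A Q\<^esub> inv\<^bsub>wreath_product A Q\<^esub> (f, \<one>\<^bsub>Q\<^esub>)) ` E)}"

text \<open>HOL has no collection of all groups, so the middle group of an extension lives on a type
  \<open>'e\<close>, which the theorem leaves arbitrary. An extension of \<open>A\<close> by \<open>Q\<close> is equipotent to
  \<open>carrier A \<times> carrier Q\<close>. If \<open>'e\<close> has at least that many elements, every extension on any type is
  equivalent to one on \<open>'e\<close>; otherwise there is no extension on \<open>'e\<close> at all. Both
  \<open>'a \<times> 'q\<close> and the type of the wreath product are always large enough.\<close>

record ('a, 'e, 'q) group_ext =
  total :: "'e monoid"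
  incl :: "'a \<Rightarrow> 'e"
  proj :: "'e \<Rightarrow> 'q"

definition group_extensions ::
    "('a, 'm) monoid_scheme \<Rightarrow> ('q, 'k) monoid_scheme \<Rightarrow> ('a, 'e, 'q) group_ext set"
  where "group_extensions A Q =
    {X. group (total X) \<and>
        incl X \<in> mon A (total X) \<and>
        proj X \<in> epi (total X) Q \<and>
        incl X ` carrier A = kernel (total X) Q (proj X)}"

text \<open>The two extensions may live on different types, so that extensions on an arbitrary type can
  be compared with subgroups of the wreath product.\<close>

definition ext_equiv ::
    "('a, 'm) monoid_scheme \<Rightarrow> ('a, 'e, 'q) group_ext \<Rightarrow> ('a, 'f, 'q) group_ext \<Rightarrow> bool"
  where "ext_equiv A X Y \<longleftrightarrow>
    (\<exists>\<theta> \<in> iso (total X) (total Y).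
       (\<forall>a \<in> carrier A. \<theta> (incl X a) = incl Y a) \<and>
       (\<forall>x \<in> carrier (total X). proj Y (\<theta> x) = proj X x))"

definition ext_equiv_rel ::
    "('a, 'm) monoid_scheme \<Rightarrow> ('q, 'k) monoid_scheme \<Rightarrow>
     (('a, 'e, 'q) group_ext \<times> ('a, 'e, 'q) group_ext) set"
  where "ext_equiv_rel A Q =
    {(X, Y). X \<in> group_extensions A Q \<and> Y \<in> group_extensions A Q \<and> ext_equiv A X Y}"

definition associated_ext ::
    "('a, 'm) monoid_scheme \<Rightarrow> ('q, 'k) monoid_scheme \<Rightarrow> (('q \<Rightarrow> 'a) \<times> 'q) set \<Rightarrow>
     ('a, ('q \<Rightarrow> 'a) \<times> 'q, 'q) group_ext"
  where "associated_ext A Q E =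
    \<lparr>total = wreath_product A Q\<lparr>carrier := E\<rparr>,
     incl = inv_into (E \<inter> wreath_base A Q) (eval_at_one Q),
     proj = snd\<rparr>"

text \<open>This is the correspondence on representatives. It is constant on equivalence classes of
  extensions, so the induced map sends a class \<open>c\<close> to
  \<open>\<Union>X\<in>c. corresponding_subgroups A Q X\<close>, the common value on \<open>c\<close>.\<close>

definition corresponding_subgroups ::
    "('a, 'm) monoid_scheme \<Rightarrow> ('q, 'k) monoid_scheme \<Rightarrow> ('a, 'e, 'q) group_ext \<Rightarrow>
     (('q \<Rightarrow> 'a) \<times> 'q) set set"
  where "corresponding_subgroups A Q X =
    {E \<in> admissible_subgroups A Q. ext_equiv A (associated_ext A Q E) X}"

end

theory Submission
  imports Defs "HOL-Algebra.Weak_Morphisms"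
begin

text \<open>A normalised section of an extension \<open>X\<close> yields an embedding of \<open>X\<close> into the wreath product
  over \<open>Q\<close> (Kaloujnine and Krasner) whose restriction to \<open>A\<close> is inverse to evaluation at \<open>1\<close>. Its
  image is an admissible subgroup with associated extension equivalent to \<open>X\<close>, and all such subgroups
  are images of such embeddings. Any two of these embeddings differ by conjugation with some
  \<open>(f, 1)\<close>, \<open>f 1 = 1\<close>. Hence two admissible subgroups are conjugate in this way iff their
  associated extensions are equivalent, and both quotients are in bijection.\<close>

text \<open>Cancellation in the form that appears once associativity has nested all products to the
  right.\<close>

lemma (in group) inv_mult_cancel_left:
  "x \<in> carrier G \<Longrightarrow> y \<in> carrier G \<Longrightarrow> inv x \<otimes> (x \<otimes> y) = y"
  "x \<in> carrier G \<Longrightarrow> y \<in> carrier G \<Longrightarrow> x \<otimes> (inv x \<otimes> y) = y"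
  by (simp_all add: m_assoc[symmetric])

section \<open>Equivalence of extensions\<close>

lemma group_extensionsD:
  assumes "X \<in> group_extensions A Q"
  shows "group (total X)" "incl X \<in> hom A (total X)" "inj_on (incl X) (carrier A)"
    "proj X \<in> hom (total X) Q" "proj X ` carrier (total X) = carrier Q"
    "incl X ` carrier A = kernel (total X) Q (proj X)"
  using assms by (auto simp: group_extensions_def mon_def epi_def)

lemma ext_equiv_refl: "ext_equiv A X X"
  unfolding ext_equiv_def by (intro bexI[OF _ iso_set_refl]) simp

lemma ext_equiv_sym:
  assumes "X \<in> group_extensions A Q" and "ext_equiv A X Y"
  shows "ext_equiv A Y X"
proof -
  interpret X: group "total X" using assms(1) by (rule group_extensionsD)
  obtain \<theta> where \<theta>: "\<theta> \<in> iso (total X) (total Y)"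
    and incl: "\<And>a. a \<in> carrier A \<Longrightarrow> \<theta> (incl X a) = incl Y a"
    and proj: "\<And>x. x \<in> carrier (total X) \<Longrightarrow> proj Y (\<theta> x) = proj X x"
    using assms(2) unfolding ext_equiv_def by blast
  have bij: "bij_betw \<theta> (carrier (total X)) (carrier (total Y))"
    using \<theta> by (simp add: iso_def)
  let ?\<eta> = "inv_into (carrier (total X)) \<theta>"
  have "?\<eta> (incl Y a) = incl X a" if "a \<in> carrier A" for a
    using that incl[OF that] bij group_extensionsD(2)[OF assms(1)]
    by (metis bij_betw_inv_into_left hom_in_carrier)
  moreover have "proj X (?\<eta> y) = proj Y y" if "y \<in> carrier (total Y)" for y
    using proj[of "?\<eta> y"] bij_betw_apply[OF bij_betw_inv_into[OF bij] that]
      bij_betw_inv_into_right[OF bij that] by simp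
  ultimately show ?thesis
    unfolding ext_equiv_def using X.iso_set_sym[OF \<theta>] by blast
qed

lemma ext_equiv_trans:
  assumes "ext_equiv A X Y" and "ext_equiv A Y Z"
  shows "ext_equiv A X Z"
proof -
  obtain \<theta> where \<theta>: "\<theta> \<in> iso (total X) (total Y)"
    and "\<And>a. a \<in> carrier A \<Longrightarrow> \<theta> (incl X a) = incl Y a"
    and "\<And>x. x \<in> carrier (total X) \<Longrightarrow> proj Y (\<theta> x) = proj X x"
    using assms(1) unfolding ext_equiv_def by blast
  moreover obtain \<eta> where \<eta>: "\<eta> \<in> iso (total Y) (total Z)"
    and "\<And>a. a \<in> carrier A \<Longrightarrow> \<eta> (incl Y a) = incl Z a"
    and "\<And>y. y \<in> carrier (total Y) \<Longrightarrow> proj Z (\<eta> y) = proj Y y"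
    using assms(2) unfolding ext_equiv_def by blast
  moreover have "\<theta> x \<in> carrier (total Y)" if "x \<in> carrier (total X)" for x
    using \<theta> that by (metis iso_imp_homomorphism hom_in_carrier)
  ultimately show ?thesis
    unfolding ext_equiv_def by (intro bexI[OF _ iso_set_trans[OF \<theta> \<eta>]]) simp
qed

text \<open>Transport of structure along an injection of the middle group into \<open>'e\<close>.
  This moves extensions realised inside the wreath product to the type on which the theorem
  considers extensions.\<close>

lemma ext_equiv_transport:
  assumes X: "X \<in> group_extensions A Q"
    and room: "carrier (total X) \<lesssim> (UNIV :: 'e set)"
  shows "\<exists>Y :: ('a, 'e, 'q) group_ext. Y \<in> group_extensions A Q \<and> ext_equiv A X Y"
proof -
  note XD = group_extensionsD[OF X]
  interpret X: group "total X" by (rule XD)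
  obtain g :: "_ \<Rightarrow> 'e" where g: "inj_on g (carrier (total X))"
    using room by (auto simp: lepoll_def)
  let ?C = "carrier (total X)" and ?G = "image_group g (total X)"
  let ?k = "inv_into ?C g"
  define Y where "Y = \<lparr>total = ?G, incl = g \<circ> incl X, proj = proj X \<circ> ?k\<rparr>"
  have g_iso: "g \<in> iso (total X) ?G" using inj_imp_image_group_iso[OF g] .
  have k_iso: "?k \<in> iso ?G (total X)" using X.iso_set_sym[OF g_iso] .
  have k: "?k (g x) = x" if "x \<in> ?C" for x using g that by simp
  have grp: "group ?G" using X.inj_imp_image_group_is_group[OF g] .
  have "g \<circ> incl X \<in> mon A ?G"
    using g_iso XD by (intro mon_compose[of _ _ "total X"]) (auto simp: mon_def iso_iff)
  moreover have "proj X \<circ> ?k \<in> epi ?G Q"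
    using k_iso XD by (intro epi_compose[of _ _ "total X"]) (auto simp: epi_def iso_iff)
  moreover have "(g \<circ> incl X) ` carrier A = kernel ?G Q (proj X \<circ> ?k)"
  proof -
    have "(g \<circ> incl X) ` carrier A = g ` kernel (total X) Q (proj X)"
      using XD(6) by (simp only: image_comp[symmetric])
    also have "\<dots> = kernel ?G Q (proj X \<circ> ?k)"
      using k by (auto simp: kernel_def image_group_carrier)
    finally show ?thesis .
  qed
  ultimately have "Y \<in> group_extensions A Q"
    using grp by (simp add: group_extensions_def Y_def)
  moreover have "ext_equiv A X Y"
    unfolding ext_equiv_def Y_def using g_iso k by (intro bexI[of _ g]) auto
  ultimately show ?thesis by blast
qed

lemma equiv_ext_equiv_rel: "equiv (group_extensions A Q) (ext_equiv_rel A Q)"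
proof (rule equivI)
  show "sym (ext_equiv_rel A Q)"
    unfolding sym_def ext_equiv_rel_def using ext_equiv_sym by auto
  show "trans (ext_equiv_rel A Q)"
    unfolding trans_def ext_equiv_rel_def using ext_equiv_trans by blast
qed (auto simp: ext_equiv_rel_def refl_on_def ext_equiv_refl)

section \<open>The wreath product\<close>

locale wreath =
  A: group A + Q: group Q
  for A :: "('a, 'm) monoid_scheme" and Q :: "('q, 'k) monoid_scheme"
begin

abbreviation W where "W \<equiv> wreath_product A Q"

lemma carrier_wreath: "carrier W = (carrier Q \<rightarrow>\<^sub>E carrier A) \<times> carrier Q"
  by (simp add: wreath_product_def semidirect_product_def)

lemma mult_wreath:
  "(f, p) \<otimes>\<^bsub>W\<^esub> (g, q) = (\<lambda>r\<in>carrier Q. f r \<otimes>\<^bsub>A\<^esub> right_translation Q p g r, p \<otimes>\<^bsub>Q\<^esub> q)"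
  by (simp add: wreath_product_def semidirect_product_def)

lemma one_wreath: "\<one>\<^bsub>W\<^esub> = (\<lambda>r\<in>carrier Q. \<one>\<^bsub>A\<^esub>, \<one>\<^bsub>Q\<^esub>)"
  by (simp add: wreath_product_def semidirect_product_def)

lemma snd_mult_wreath: "snd (x \<otimes>\<^bsub>W\<^esub> y) = snd x \<otimes>\<^bsub>Q\<^esub> snd y"
  by (cases x; cases y) (simp add: mult_wreath)

lemma fst_mult_wreath:
  "r \<in> carrier Q \<Longrightarrow> fst (x \<otimes>\<^bsub>W\<^esub> y) r = fst x r \<otimes>\<^bsub>A\<^esub> fst y (r \<otimes>\<^bsub>Q\<^esub> snd x)"
  by (cases x; cases y) (simp add: mult_wreath right_translation_def)

lemma wreath_eqI:
  assumes "x \<in> carrier W" "y \<in> carrier W" "snd x = snd y"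
    and "\<And>r. r \<in> carrier Q \<Longrightarrow> fst x r = fst y r"
  shows "x = y"
proof (rule prod_eqI)
  show "fst x = fst y"
    by (rule PiE_ext[where k = "carrier Q" and s = "\<lambda>_. carrier A"])
      (use assms in \<open>auto simp: carrier_wreath\<close>)
qed (rule assms(3))

lemma fst_wreath_closed: "x \<in> carrier W \<Longrightarrow> r \<in> carrier Q \<Longrightarrow> fst x r \<in> carrier A"
  by (auto simp: carrier_wreath)

lemma snd_wreath_closed: "x \<in> carrier W \<Longrightarrow> snd x \<in> carrier Q"
  by (auto simp: carrier_wreath)

lemma mult_wreath_closed: "x \<in> carrier W \<Longrightarrow> y \<in> carrier W \<Longrightarrow> x \<otimes>\<^bsub>W\<^esub> y \<in> carrier W"
  by (cases x; cases y)
    (auto simp: mult_wreath carrier_wreath right_translation_def PiE_iff)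

lemma group_wreath: "group W"
proof (rule groupI)
  show "\<one>\<^bsub>W\<^esub> \<in> carrier W" by (simp add: one_wreath carrier_wreath)
next
  fix x y z assume "x \<in> carrier W" "y \<in> carrier W" "z \<in> carrier W"
  then show "x \<otimes>\<^bsub>W\<^esub> y \<otimes>\<^bsub>W\<^esub> z = x \<otimes>\<^bsub>W\<^esub> (y \<otimes>\<^bsub>W\<^esub> z)"
    by (intro wreath_eqI)
      (simp_all add: mult_wreath_closed fst_mult_wreath snd_mult_wreath fst_wreath_closed
        snd_wreath_closed A.m_assoc Q.m_assoc)
next
  fix x assume x: "x \<in> carrier W"
  show "\<one>\<^bsub>W\<^esub> \<otimes>\<^bsub>W\<^esub> x = x"
    using x
    by (intro wreath_eqI mult_wreath_closed)
      (simp_all add: fst_mult_wreath snd_mult_wreath fst_wreath_closed snd_wreath_closed,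
        simp_all add: one_wreath carrier_wreath fst_wreath_closed snd_wreath_closed)
  \<comment> \<open>The inverse of \<open>(f, q)\<close> has first component \<open>f\<close>
    shifted by the inverse of \<open>q\<close> and then inverted pointwise; \<open>groupI\<close>
    asks only for a left inverse.\<close>
  let ?q = "inv\<^bsub>Q\<^esub> (snd x)"
  let ?y = "(\<lambda>r\<in>carrier Q. inv\<^bsub>A\<^esub> fst x (r \<otimes>\<^bsub>Q\<^esub> ?q), ?q)"
  have "?y \<in> carrier W" using x by (auto simp: carrier_wreath PiE_iff)
  moreover have "?y \<otimes>\<^bsub>W\<^esub> x = \<one>\<^bsub>W\<^esub>"
    using x by (cases x) (auto simp: mult_wreath one_wreath carrier_wreath right_translation_def PiE_iff
        intro!: restrict_ext)
  ultimately show "\<exists>y\<in>carrier W. y \<otimes>\<^bsub>W\<^esub> x = \<one>\<^bsub>W\<^esub>" by blast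
qed (rule mult_wreath_closed)

sublocale W: group W by (rule group_wreath)

lemma snd_hom: "snd \<in> hom W Q"
  by (auto simp: hom_def snd_mult_wreath snd_wreath_closed)

text \<open>In a product the right factor is read at \<open>snd x\<close>, which is \<open>1\<close>
  for \<open>x\<close> in the base. The right factor may therefore lie anywhere in the wreath
  product.\<close>

lemma eval_mult_base:
  assumes "x \<in> wreath_base A Q"
  shows "eval_at_one Q (x \<otimes>\<^bsub>W\<^esub> y) = eval_at_one Q x \<otimes>\<^bsub>A\<^esub> eval_at_one Q y"
  using assms by (simp add: eval_at_one_def fst_mult_wreath wreath_base_def kernel_def)

section \<open>Conjugation by base elements\<close>

definition base_conj where
  "base_conj f x = (f, \<one>\<^bsub>Q\<^esub>) \<otimes>\<^bsub>W\<^esub> x \<otimes>\<^bsub>W\<^esub> inv\<^bsub>W\<^esub> (f, \<one>\<^bsub>Q\<^esub>)"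

lemma inv_base:
  assumes "f \<in> carrier (base_group A Q)"
  shows "inv\<^bsub>W\<^esub> (f, \<one>\<^bsub>Q\<^esub>) = (\<lambda>r\<in>carrier Q. inv\<^bsub>A\<^esub> f r, \<one>\<^bsub>Q\<^esub>)"
  using assms
  by (intro W.inv_equality)
    (auto simp: mult_wreath one_wreath carrier_wreath right_translation_def PiE_iff
      intro!: restrict_ext)

text \<open>The right-hand conjugator is read at a translated argument. When \<open>snd x\<close>,
  \<open>r\<close> and \<open>f 1\<close> are all \<open>1\<close>, the value of \<open>x\<close> is
  unchanged, which explains the condition on \<open>f\<close> in the conjugation relation.\<close>

lemma
  assumes f: "f \<in> carrier (base_group A Q)" and x: "x \<in> carrier W"
  shows base_conj_closed: "base_conj f x \<in> carrier W"
    and snd_base_conj: "snd (base_conj f x) = snd x"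
    and fst_base_conj: "r \<in> carrier Q \<Longrightarrow>
      fst (base_conj f x) r = f r \<otimes>\<^bsub>A\<^esub> fst x r \<otimes>\<^bsub>A\<^esub> inv\<^bsub>A\<^esub> f (r \<otimes>\<^bsub>Q\<^esub> snd x)"
proof -
  have fW: "(f, \<one>\<^bsub>Q\<^esub>) \<in> carrier W" using f by (simp add: carrier_wreath)
  then show "base_conj f x \<in> carrier W" using x by (simp add: base_conj_def)
  show "snd (base_conj f x) = snd x"
    using x by (simp add: base_conj_def snd_mult_wreath inv_base[OF f] snd_wreath_closed)
  show "fst (base_conj f x) r = f r \<otimes>\<^bsub>A\<^esub> fst x r \<otimes>\<^bsub>A\<^esub> inv\<^bsub>A\<^esub> f (r \<otimes>\<^bsub>Q\<^esub> snd x)"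
    if "r \<in> carrier Q"
    using x that
    by (simp add: base_conj_def snd_mult_wreath fst_mult_wreath inv_base[OF f] snd_wreath_closed)
qed

lemma base_conj_hom:
  assumes f: "f \<in> carrier (base_group A Q)"
  shows "base_conj f \<in> hom W W"
proof (rule homI)
  have fW: "(f, \<one>\<^bsub>Q\<^esub>) \<in> carrier W" using f by (simp add: carrier_wreath)
  fix x y assume "x \<in> carrier W" "y \<in> carrier W"
  then show "base_conj f (x \<otimes>\<^bsub>W\<^esub> y) = base_conj f x \<otimes>\<^bsub>W\<^esub> base_conj f y"
    using fW by (simp add: base_conj_def W.m_assoc W.inv_mult_cancel_left)
qed (rule base_conj_closed[OF f])

section \<open>Embeddings of extensions\<close>

text \<open>Injectivity and admissibility of the image follow from these conditions, so membership
  of a constructed map is checked on values only.\<close>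

definition wreath_maps where
  "wreath_maps X = {h \<in> hom (total X) W. (\<forall>x \<in> carrier (total X). snd (h x) = proj X x) \<and>
     (\<forall>a \<in> carrier A. eval_at_one Q (h (incl X a)) = a)}"

lemma wreath_mapsD:
  assumes "h \<in> wreath_maps X"
  shows "h \<in> hom (total X) W" "\<And>x. x \<in> carrier (total X) \<Longrightarrow> snd (h x) = proj X x"
    "\<And>a. a \<in> carrier A \<Longrightarrow> eval_at_one Q (h (incl X a)) = a"
  using assms by (auto simp: wreath_maps_def)

text \<open>For a section \<open>s\<close> of the projection with \<open>s 1 = 1\<close>, an element \<open>x\<close> over \<open>q\<close> goes to the
  function \<open>r \<mapsto> s r \<cdot> x \<cdot> (s (r q))\<inverse>\<close>.\<close>

lemma wreath_maps_nonempty: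
  assumes X: "X \<in> group_extensions A Q"
  shows "wreath_maps X \<noteq> {}"
proof -
  note XD = group_extensionsD[OF X]
  interpret E: group "total X" by (rule XD)
  interpret p: group_hom "total X" Q "proj X" using XD(4) by unfold_locales
  interpret i: group_hom A "total X" "incl X" using XD(2) by unfold_locales
  \<comment> \<open>\<open>inv_into\<close> alone might choose another preimage of \<open>1\<close>.
    The case split forces \<open>s 1 = 1\<close>, so that \<open>c\<close> at \<open>1\<close> fixes
    every \<open>incl X a\<close>.\<close>
  define s where "s q = (if q = \<one>\<^bsub>Q\<^esub> then \<one>\<^bsub>total X\<^esub>
    else inv_into (carrier (total X)) (proj X) q)" for q
  have s: "s q \<in> carrier (total X)" "proj X (s q) = q" if "q \<in> carrier Q" for q
    using that XD(5) by (auto simp: s_def intro: inv_into_into f_inv_into_f)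
  define j where "j = inv_into (carrier A) (incl X)"
  have j: "j y \<in> carrier A" "incl X (j y) = y" if "y \<in> kernel (total X) Q (proj X)" for y
    using that XD(6) unfolding j_def by (metis inv_into_into f_inv_into_f)+
  have ji: "j (incl X a) = a" if "a \<in> carrier A" for a
    using that XD(3) by (simp add: j_def)
  \<comment> \<open>With \<open>q = proj X x\<close>, both \<open>s r\<close> times \<open>x\<close>
    and \<open>s (r q)\<close> lie over \<open>r q\<close>, so their quotient lies in the kernel and
    \<open>j\<close> can take it back to \<open>A\<close>.\<close>
  define c where "c r x = s r \<otimes>\<^bsub>total X\<^esub> x \<otimes>\<^bsub>total X\<^esub> inv\<^bsub>total X\<^esub> s (r \<otimes>\<^bsub>Q\<^esub> proj X x)" for r x
  have c: "c r x \<in> kernel (total X) Q (proj X)"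
    if "r \<in> carrier Q" "x \<in> carrier (total X)" for r x
    using that s by (simp add: c_def kernel_def)
  \<comment> \<open>The factor \<open>s (r q)\<close> with \<open>q = proj X x\<close> cancels
    against its inverse; what remains is the multiplication rule of the wreath product.\<close>
  have cc: "c r (x \<otimes>\<^bsub>total X\<^esub> y) = c r x \<otimes>\<^bsub>total X\<^esub> c (r \<otimes>\<^bsub>Q\<^esub> proj X x) y"
    if "r \<in> carrier Q" "x \<in> carrier (total X)" "y \<in> carrier (total X)" for r x y
    using that s by (simp add: c_def E.m_assoc Q.m_assoc E.inv_mult_cancel_left)
  have jc: "j (c r (x \<otimes>\<^bsub>total X\<^esub> y)) = j (c r x) \<otimes>\<^bsub>A\<^esub> j (c (r \<otimes>\<^bsub>Q\<^esub> proj X x) y)"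
    if "r \<in> carrier Q" "x \<in> carrier (total X)" "y \<in> carrier (total X)" for r x y
    using that j[OF c] by (metis cc i.hom_mult ji A.m_closed Q.m_closed p.hom_closed)
  define h where "h x = (\<lambda>r\<in>carrier Q. j (c r x), proj X x)" for x
  have "h \<in> hom (total X) W"
  proof (rule homI)
    fix x assume "x \<in> carrier (total X)"
    then show "h x \<in> carrier W" using j(1)[OF c] by (simp add: h_def carrier_wreath)
  next
    fix x y assume "x \<in> carrier (total X)" "y \<in> carrier (total X)"
    then show "h (x \<otimes>\<^bsub>total X\<^esub> y) = h x \<otimes>\<^bsub>W\<^esub> h y"
      by (auto simp: h_def mult_wreath right_translation_def jc)
  qed
  moreover have "eval_at_one Q (h (incl X a)) = a" if a: "a \<in> carrier A" for a
  proof -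
    have "proj X (incl X a) = \<one>\<^bsub>Q\<^esub>" using a XD(6) by (auto simp: kernel_def)
    then have "c \<one>\<^bsub>Q\<^esub> (incl X a) = incl X a" using a by (simp add: c_def s_def)
    then show ?thesis using a ji by (simp add: eval_at_one_def h_def)
  qed
  ultimately have "h \<in> wreath_maps X" by (simp add: wreath_maps_def h_def)
  then show ?thesis by blast
qed

text \<open>An element sent to \<open>1\<close> lies over \<open>1\<close>, hence equals some
  \<open>incl X a\<close>, and evaluation recovers \<open>a = 1\<close>.\<close>

lemma wreath_map_inj:
  assumes X: "X \<in> group_extensions A Q" and h: "h \<in> wreath_maps X"
  shows "inj_on h (carrier (total X))"
proof -
  note XD = group_extensionsD[OF X] and hD = wreath_mapsD[OF h]
  have "x = \<one>\<^bsub>total X\<^esub>" if x: "x \<in> carrier (total X)" "h x = \<one>\<^bsub>W\<^esub>" for x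
  proof -
    have "x \<in> incl X ` carrier A"
      using x hD(2)[of x] XD(6) by (simp add: kernel_def one_wreath)
    then obtain a where a: "a \<in> carrier A" "x = incl X a" by blast
    then have "a = \<one>\<^bsub>A\<^esub>" using x hD(3)[of a] by (simp add: eval_at_one_def one_wreath)
    then show ?thesis using a XD(1,2) hom_one A.group_axioms by blast
  qed
  then show ?thesis
    using inj_on_one_iff'[OF hD(1) XD(1) group_wreath] by blast
qed

text \<open>Since \<open>h\<close> respects the projections, its image meets the base exactly in the
  elements \<open>h (incl X a)\<close>, and on these evaluation is inverse to \<open>a\<close> going
  to \<open>h (incl X a)\<close>.\<close>

lemma wreath_map_image:
  assumes X: "X \<in> group_extensions A Q" and h: "h \<in> wreath_maps X"
  shows "h ` carrier (total X) \<in> admissible_subgroups A Q"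
    and "ext_equiv A X (associated_ext A Q (h ` carrier (total X)))"
proof -
  note XD = group_extensionsD[OF X] and hD = wreath_mapsD[OF h]
  interpret E: group "total X" by (rule XD)
  interpret h: group_hom "total X" W h using hD(1) by unfold_locales
  let ?E = "h ` carrier (total X)"
  let ?B = "?E \<inter> wreath_base A Q"
  have incl: "incl X a \<in> carrier (total X)" if "a \<in> carrier A" for a
    using that XD(2) by (rule hom_in_carrier[rotated])
  have B: "?B = (\<lambda>a. h (incl X a)) ` carrier A"
  proof -
    have "?B = h ` kernel (total X) Q (proj X)"
      using hD(2) h.hom_closed by (auto simp: wreath_base_def kernel_def)
    then show ?thesis using XD(6) by (metis image_image)
  qed
  have bij: "bij_betw (eval_at_one Q) ?B (carrier A)"
    by (rule bij_betw_byWitness[where f' = "\<lambda>a. h (incl X a)"]) (auto simp: B hD(3))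
  then have iso: "eval_at_one Q \<in> iso (W\<lparr>carrier := ?B\<rparr>) A"
    by (auto simp: iso_def eval_mult_base intro!: homI dest: bij_betwE)
  have snd: "snd ` ?E = carrier Q"
    using hD(2) XD(5) by (simp add: image_image cong: image_cong)
  show "?E \<in> admissible_subgroups A Q"
    using h.img_is_subgroup snd iso by (simp add: admissible_subgroups_def)
  have "h \<in> iso (total X) (W\<lparr>carrier := ?E\<rparr>)"
    using wreath_map_inj[OF X h] hD(1) by (auto simp: iso_iff hom_def)
  moreover have "h (incl X a) = inv_into ?B (eval_at_one Q) a" if "a \<in> carrier A" for a
    using that bij B by (intro inv_into_f_eq[symmetric]) (auto simp: bij_betw_def hD(3))
  ultimately show "ext_equiv A X (associated_ext A Q ?E)"
    unfolding ext_equiv_def associated_ext_def using hD(2) by (intro bexI[of _ h]) auto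
qed

section \<open>Admissible subgroups and their extensions\<close>

lemma admissible_subgroupsD:
  assumes "E \<in> admissible_subgroups A Q"
  shows "subgroup E W" "snd ` E = carrier Q"
    "eval_at_one Q \<in> iso (W\<lparr>carrier := E \<inter> wreath_base A Q\<rparr>) A"
    "bij_betw (eval_at_one Q) (E \<inter> wreath_base A Q) (carrier A)"
  using assms by (auto simp: admissible_subgroups_def iso_def)

text \<open>The kernel of \<open>snd\<close> on \<open>E\<close> is \<open>E\<close> intersected
  with the base, which is exactly the image of the inverse of evaluation.\<close>

lemma associated_ext:
  assumes E: "E \<in> admissible_subgroups A Q"
  shows "associated_ext A Q E \<in> group_extensions A Q"
proof -
  note ED = admissible_subgroupsD[OF E]
  let ?B = "E \<inter> wreath_base A Q"
  interpret snd: group_hom W Q snd using snd_hom by unfold_locales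
  have "subgroup (wreath_base A Q) W"
    unfolding wreath_base_def by (rule snd.subgroup_kernel)
  then have "subgroup ?B W"
    using ED(1) W.subgroups_Inter_pair by blast
  then interpret B: group "W\<lparr>carrier := ?B\<rparr>" by (rule W.subgroup_imp_group)
  have grp: "group (W\<lparr>carrier := E\<rparr>)" using ED(1) by (rule W.subgroup_imp_group)
  have inv: "inv_into ?B (eval_at_one Q) \<in> iso A (W\<lparr>carrier := ?B\<rparr>)"
    using B.iso_set_sym[OF ED(3)] by simp
  then have "inv_into ?B (eval_at_one Q) \<in> mon A (W\<lparr>carrier := E\<rparr>)"
    by (auto simp: iso_iff mon_def hom_def)
  moreover have "snd \<in> epi (W\<lparr>carrier := E\<rparr>) Q"
    using ED(2) subgroup.subset[OF ED(1)] snd_hom by (auto simp: epi_def hom_def snd_mult_wreath)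
  moreover have "inv_into ?B (eval_at_one Q) ` carrier A = kernel (W\<lparr>carrier := E\<rparr>) Q snd"
    using inv subgroup.subset[OF ED(1)] by (auto simp: iso_iff kernel_def wreath_base_def)
  ultimately show ?thesis
    using grp by (simp add: group_extensions_def associated_ext_def)
qed

text \<open>Converse to \<open>wreath_map_image\<close>: an equivalence followed by the inclusion of
  \<open>E\<close> is an embedding of the required kind.\<close>

lemma ext_equiv_associated_wreath_map:
  assumes E: "E \<in> admissible_subgroups A Q" and eq: "ext_equiv A X (associated_ext A Q E)"
  obtains h where "h \<in> wreath_maps X" "E = h ` carrier (total X)"
proof -
  note ED = admissible_subgroupsD[OF E]
  obtain h where h: "h \<in> iso (total X) (W\<lparr>carrier := E\<rparr>)"
    and incl: "\<And>a. a \<in> carrier A \<Longrightarrow> h (incl X a) = inv_into (E \<inter> wreath_base A Q) (eval_at_one Q) a"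
    and proj: "\<And>x. x \<in> carrier (total X) \<Longrightarrow> snd (h x) = proj X x"
    using eq unfolding ext_equiv_def associated_ext_def by auto
  have "h \<in> hom (total X) W"
    using h subgroup.subset[OF ED(1)] by (auto simp: iso_def hom_def)
  moreover have "eval_at_one Q (h (incl X a)) = a" if "a \<in> carrier A" for a
    using that incl ED(4) by (simp add: bij_betw_inv_into_right)
  ultimately have "h \<in> wreath_maps X" using proj by (simp add: wreath_maps_def)
  moreover have "E = h ` carrier (total X)" using h by (simp add: iso_iff)
  ultimately show ?thesis by (rule that)
qed

section \<open>Conjugacy of embeddings and of their images\<close>

text \<open>Write \<open>c x\<close>, \<open>c' x\<close> for the values at \<open>1\<close> of \<open>h x\<close>, \<open>h' x\<close>. Multiplying \<open>x\<close> from the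
  left by \<open>incl a\<close> multiplies both by \<open>a\<close>, so \<open>(c' x)\<inverse> \<cdot> c x\<close> only depends on \<open>proj x\<close>; it is
  the conjugating function. Since \<open>c (y x) = c y \<cdot> fst (h x) (proj y)\<close>, the values \<open>c\<close> determine
  \<open>h\<close>.\<close>

lemma wreath_maps_conj:
  assumes X: "X \<in> group_extensions A Q" and h: "h \<in> wreath_maps X" and h': "h' \<in> wreath_maps X"
  obtains f where "f \<in> carrier (base_group A Q)" "f \<one>\<^bsub>Q\<^esub> = \<one>\<^bsub>A\<^esub>"
    "\<And>x. x \<in> carrier (total X) \<Longrightarrow> h' x = base_conj f (h x)"
proof -
  note XD = group_extensionsD[OF X]
  interpret E: group "total X" by (rule XD)
  interpret p: group_hom "total X" Q "proj X" using XD(4) by unfold_locales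
  \<comment> \<open>An arbitrary section suffices here: \<open>f_eq\<close> will show that
    \<open>f\<close> does not depend on the choice.\<close>
  define s where "s = inv_into (carrier (total X)) (proj X)"
  have s: "s q \<in> carrier (total X)" "proj X (s q) = q" if "q \<in> carrier Q" for q
    using that XD(5) by (auto simp: s_def intro: inv_into_into f_inv_into_f)
  have c_mult: "eval_at_one Q (g (y \<otimes>\<^bsub>total X\<^esub> x)) = eval_at_one Q (g y) \<otimes>\<^bsub>A\<^esub> fst (g x) (proj X y)"
    if "g \<in> wreath_maps X" "y \<in> carrier (total X)" "x \<in> carrier (total X)" for g x y
    using that wreath_mapsD[OF that(1)]
    by (simp add: eval_at_one_def hom_mult fst_mult_wreath)
  have closed: "g x \<in> carrier W" if "g \<in> wreath_maps X" "x \<in> carrier (total X)" for g x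
    using that wreath_mapsD(1) hom_in_carrier by metis
  have cA: "eval_at_one Q (g x) \<in> carrier A"
    if "g \<in> wreath_maps X" "x \<in> carrier (total X)" for g x
    using closed[OF that] by (simp add: eval_at_one_def fst_wreath_closed)
  define c c' where "c x = eval_at_one Q (h x)" and "c' x = eval_at_one Q (h' x)" for x
  note cA = cA[OF h, folded c_def] cA[OF h', folded c'_def]
  note c_mult = c_mult[OF h, folded c_def] c_mult[OF h', folded c'_def]
  define f where "f = (\<lambda>r\<in>carrier Q. inv\<^bsub>A\<^esub> c' (s r) \<otimes>\<^bsub>A\<^esub> c (s r))"
  have f: "f \<in> carrier (base_group A Q)" using s cA by (simp add: f_def)
  have incl: "incl X a \<in> carrier (total X)" "proj X (incl X a) = \<one>\<^bsub>Q\<^esub>"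
    "c (incl X a) = a" "c' (incl X a) = a" if "a \<in> carrier A" for a
    using that XD(6) wreath_mapsD(3)[OF h] wreath_mapsD(3)[OF h']
    by (auto simp: kernel_def c_def c'_def)
  have f_eq: "f (proj X x) = inv\<^bsub>A\<^esub> c' x \<otimes>\<^bsub>A\<^esub> c x" if x: "x \<in> carrier (total X)" for x
  proof -
    \<comment> \<open>\<open>x\<close> and \<open>?y\<close> lie over the same element, so they
      differ by a left factor \<open>incl X a\<close>; the resulting \<open>a\<close> cancels in the
      quotient of \<open>c'\<close> and \<open>c\<close>.\<close>
    let ?y = "s (proj X x)"
    have y: "?y \<in> carrier (total X)" "proj X ?y = proj X x" using x s by auto
    then have "x \<otimes>\<^bsub>total X\<^esub> inv\<^bsub>total X\<^esub> ?y \<in> incl X ` carrier A"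
      using x XD(6) by (simp add: kernel_def)
    then obtain a where a: "a \<in> carrier A" "incl X a = x \<otimes>\<^bsub>total X\<^esub> inv\<^bsub>total X\<^esub> ?y" by force
    then have "incl X a \<otimes>\<^bsub>total X\<^esub> ?y = x" using x y by (simp add: E.m_assoc)
    moreover have "c (incl X a \<otimes>\<^bsub>total X\<^esub> ?y) = a \<otimes>\<^bsub>A\<^esub> c ?y"
      and "c' (incl X a \<otimes>\<^bsub>total X\<^esub> ?y) = a \<otimes>\<^bsub>A\<^esub> c' ?y"
      using c_mult[OF incl(1)[OF a(1)] y(1)] incl(2-4)[OF a(1)]
      by (simp_all add: c_def c'_def eval_at_one_def)
    ultimately have "c x = a \<otimes>\<^bsub>A\<^esub> c ?y" "c' x = a \<otimes>\<^bsub>A\<^esub> c' ?y"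
      by simp_all
    then show ?thesis
      using a(1) x y cA by (simp add: f_def A.inv_mult_group A.m_assoc A.inv_mult_cancel_left)
  qed
  \<comment> \<open>The element \<open>incl X 1\<close> lies over \<open>1\<close>, and both
    \<open>c\<close> and \<open>c'\<close> are \<open>1\<close> on it.\<close>
  have "f \<one>\<^bsub>Q\<^esub> = \<one>\<^bsub>A\<^esub>" using f_eq[of "incl X \<one>\<^bsub>A\<^esub>"] by (simp add: incl)
  moreover have "h' x = base_conj f (h x)" if x: "x \<in> carrier (total X)" for x
  proof (rule wreath_eqI)
    show "h' x \<in> carrier W" "base_conj f (h x) \<in> carrier W"
      using x h h' f by (auto intro: closed base_conj_closed)
    show "snd (h' x) = snd (base_conj f (h x))"
      using x closed[OF h x] f wreath_mapsD(2)[OF h] wreath_mapsD(2)[OF h']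
      by (simp add: snd_base_conj)
    fix r assume r: "r \<in> carrier Q"
    \<comment> \<open>Multiplying by \<open>s r\<close> turns the value at \<open>r\<close> into a
      quotient of values at \<open>1\<close>. After substitution \<open>c (s r)\<close> and
      \<open>c ?z\<close> cancel, leaving the inverse of \<open>c' (s r)\<close> times
      \<open>c' ?z\<close>.\<close>
    let ?z = "s r \<otimes>\<^bsub>total X\<^esub> x"
    have "c ?z = c (s r) \<otimes>\<^bsub>A\<^esub> fst (h x) r" "c' ?z = c' (s r) \<otimes>\<^bsub>A\<^esub> fst (h' x) r"
      using c_mult[OF s(1)[OF r] x] s(2)[OF r] by simp_all
    moreover have "fst (base_conj f (h x)) r =
        inv\<^bsub>A\<^esub> c' (s r) \<otimes>\<^bsub>A\<^esub> c (s r) \<otimes>\<^bsub>A\<^esub> fst (h x) r \<otimes>\<^bsub>A\<^esub> inv\<^bsub>A\<^esub> (inv\<^bsub>A\<^esub> c' ?z \<otimes>\<^bsub>A\<^esub> c ?z)"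
      using f_eq[of "s r"] f_eq[of ?z] s[OF r] x r closed[OF h x] f wreath_mapsD(2)[OF h]
      by (simp add: fst_base_conj)
    moreover have "fst (h x) r \<in> carrier A" "fst (h' x) r \<in> carrier A"
      using closed[OF h x] closed[OF h' x] r by (auto intro: fst_wreath_closed)
    ultimately show "fst (h' x) r = fst (base_conj f (h x)) r"
      using s(1)[OF r] cA by (simp add: A.inv_mult_group A.m_assoc A.inv_mult_cancel_left)
  qed
  ultimately show ?thesis by (intro that[OF f])
qed

text \<open>Conjugation by a base element keeps the projection, and over \<open>1\<close> the
  condition \<open>f 1 = 1\<close> keeps the value at \<open>1\<close>.\<close>

lemma base_conj_wreath_maps:
  assumes X: "X \<in> group_extensions A Q" and h: "h \<in> wreath_maps X"
    and f: "f \<in> carrier (base_group A Q)" "f \<one>\<^bsub>Q\<^esub> = \<one>\<^bsub>A\<^esub>"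
  shows "base_conj f \<circ> h \<in> wreath_maps X"
proof -
  note XD = group_extensionsD[OF X] and hD = wreath_mapsD[OF h]
  have closed: "h x \<in> carrier W" if "x \<in> carrier (total X)" for x
    using that hD(1) hom_in_carrier by metis
  have "incl X a \<in> carrier (total X)" "proj X (incl X a) = \<one>\<^bsub>Q\<^esub>" if "a \<in> carrier A" for a
    using that XD(6) by (auto simp: kernel_def)
  then have "eval_at_one Q (base_conj f (h (incl X a))) = a" if "a \<in> carrier A" for a
    using that hD(2,3) f closed by (simp add: eval_at_one_def fst_base_conj)
  moreover have "base_conj f \<circ> h \<in> hom (total X) W"
    using hD(1) base_conj_hom[OF f(1)] by (rule Group.hom_compose)
  ultimately show ?thesis
    using f(1) closed hD(2) by (simp add: wreath_maps_def snd_base_conj)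
qed

text \<open>Conjugating an embedding with image \<open>E\<close> gives another embedding of the same
  extension, with the conjugate as image. Conversely, an equivalence yields a second embedding of
  that extension, conjugate to the first by \<open>wreath_maps_conj\<close>.\<close>

lemma base_conj_rel_iff:
  "(E, E') \<in> base_conj_rel A Q \<longleftrightarrow> E \<in> admissible_subgroups A Q \<and> E' \<in> admissible_subgroups A Q
     \<and> ext_equiv A (associated_ext A Q E) (associated_ext A Q E')"
proof -
  have "(\<exists>f \<in> carrier (base_group A Q). f \<one>\<^bsub>Q\<^esub> = \<one>\<^bsub>A\<^esub> \<and> E' = base_conj f ` E) \<longleftrightarrow>
      ext_equiv A (associated_ext A Q E) (associated_ext A Q E')" (is "?L \<longleftrightarrow> ?R")
    if E: "E \<in> admissible_subgroups A Q" and E': "E' \<in> admissible_subgroups A Q"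
  proof -
    let ?X = "associated_ext A Q E"
    note X = associated_ext[OF E]
    \<comment> \<open>Reflexivity of equivalence supplies an embedding of the extension of
      \<open>E\<close> with image \<open>E\<close>; the inclusion is one such map.\<close>
    obtain h where h: "h \<in> wreath_maps ?X" "E = h ` carrier (total ?X)"
      using ext_equiv_associated_wreath_map[OF E ext_equiv_refl] .
    show ?thesis
    proof
      assume ?L
      then obtain f where f: "f \<in> carrier (base_group A Q)" "f \<one>\<^bsub>Q\<^esub> = \<one>\<^bsub>A\<^esub>"
        and "E' = base_conj f ` E" by blast
      then have "E' = (base_conj f \<circ> h) ` carrier (total ?X)"
        using h(2) by (metis image_comp)
      then show ?R
        using wreath_map_image(2)[OF X base_conj_wreath_maps[OF X h(1) f]] by simp
    next
      assume ?R
      then obtain h' where h': "h' \<in> wreath_maps ?X" "E' = h' ` carrier (total ?X)"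
        using ext_equiv_associated_wreath_map[OF E'] by blast
      obtain f where f: "f \<in> carrier (base_group A Q)" "f \<one>\<^bsub>Q\<^esub> = \<one>\<^bsub>A\<^esub>"
        and eq: "\<And>x. x \<in> carrier (total ?X) \<Longrightarrow> h' x = base_conj f (h x)"
        using wreath_maps_conj[OF X h(1) h'(1)] by blast
      have "E' = (\<lambda>x. base_conj f (h x)) ` carrier (total ?X)"
        using h'(2) eq by (simp cong: image_cong)
      also have "\<dots> = base_conj f ` E" by (metis h(2) image_image)
      finally show ?L using f by blast
    qed
  qed
  then show ?thesis
    unfolding base_conj_rel_def base_conj_def by auto
qed

text \<open>Inherited from equivalence of extensions, without composing or inverting conjugating
  functions.\<close>

lemma equiv_base_conj_rel: "equiv (admissible_subgroups A Q) (base_conj_rel A Q)"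
proof (rule equivI)
  show "sym (base_conj_rel A Q)"
    unfolding sym_def base_conj_rel_iff using ext_equiv_sym associated_ext by blast
  show "trans (base_conj_rel A Q)"
    unfolding trans_def base_conj_rel_iff using ext_equiv_trans by blast
qed (auto simp: base_conj_rel_iff refl_on_def ext_equiv_refl)

section \<open>The correspondence on classes\<close>

lemma corresponding_subgroups_nonempty:
  assumes X: "X \<in> group_extensions A Q"
  shows "corresponding_subgroups A Q X \<noteq> {}"
proof -
  obtain h where h: "h \<in> wreath_maps X" using wreath_maps_nonempty[OF X] by blast
  show ?thesis
    using wreath_map_image[OF X h] ext_equiv_sym[OF X] by (auto simp: corresponding_subgroups_def)
qed

lemma corresponding_subgroups_eq_class:
  assumes E: "E \<in> corresponding_subgroups A Q X"
  shows "corresponding_subgroups A Q X = base_conj_rel A Q `` {E}"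
proof -
  have E: "E \<in> admissible_subgroups A Q" "ext_equiv A (associated_ext A Q E) X"
    using E by (auto simp: corresponding_subgroups_def)
  have X: "ext_equiv A X (associated_ext A Q E)"
    using E ext_equiv_sym associated_ext by blast
  have "ext_equiv A (associated_ext A Q E') X \<longleftrightarrow>
      ext_equiv A (associated_ext A Q E) (associated_ext A Q E')"
    if E': "E' \<in> admissible_subgroups A Q" for E'
  proof
    assume "ext_equiv A (associated_ext A Q E') X"
    then show "ext_equiv A (associated_ext A Q E) (associated_ext A Q E')"
      using ext_equiv_trans[OF _ X] ext_equiv_sym associated_ext[OF E'] by blast
  next
    assume "ext_equiv A (associated_ext A Q E) (associated_ext A Q E')"
    then show "ext_equiv A (associated_ext A Q E') X"
      using ext_equiv_trans[OF _ E(2)] ext_equiv_sym associated_ext[OF E(1)] by blast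
  qed
  then show ?thesis
    using E(1) by (auto simp: corresponding_subgroups_def base_conj_rel_iff)
qed

lemma corresponding_subgroups_cong:
  assumes "X \<in> group_extensions A Q" "ext_equiv A X Y"
  shows "corresponding_subgroups A Q X = corresponding_subgroups A Q Y"
  unfolding corresponding_subgroups_def
  using ext_equiv_trans[OF _ assms(2)] ext_equiv_trans[OF _ ext_equiv_sym[OF assms]] by blast

text \<open>Well-definedness and injectivity in one statement: a subgroup corresponding to both
  \<open>X\<close> and \<open>Y\<close> links them through its associated extension.\<close>

lemma ext_equiv_iff_corresponding_subgroups_eq:
  assumes X: "X \<in> group_extensions A Q"
  shows "ext_equiv A X Y \<longleftrightarrow> corresponding_subgroups A Q X = corresponding_subgroups A Q Y"
proof
  assume eq: "corresponding_subgroups A Q X = corresponding_subgroups A Q Y"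
  obtain E where E: "E \<in> corresponding_subgroups A Q X"
    using corresponding_subgroups_nonempty[OF X] by blast
  with eq have "E \<in> corresponding_subgroups A Q Y" by simp
  with E show "ext_equiv A X Y"
    unfolding corresponding_subgroups_def using ext_equiv_sym ext_equiv_trans associated_ext by blast
qed (rule corresponding_subgroups_cong[OF X])

text \<open>Two elements of \<open>E\<close> with the same value at \<open>1\<close> and the same
  projection have a quotient in the base that evaluates to \<open>1\<close>, and evaluation is
  injective there. The bound lets associated extensions fit into \<open>'e\<close>.\<close>

lemma admissible_lepoll:
  assumes E: "E \<in> admissible_subgroups A Q"
  shows "E \<lesssim> carrier A \<times> carrier Q"
proof -
  note ED = admissible_subgroupsD[OF E]
  interpret E: subgroup E W by (rule ED(1))
  have "x = y" if xy: "x \<in> E" "y \<in> E" "eval_at_one Q x = eval_at_one Q y" "snd x = snd y" for x y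
  proof -
    have W: "x \<in> carrier W" "y \<in> carrier W" using xy by auto
    let ?z = "x \<otimes>\<^bsub>W\<^esub> inv\<^bsub>W\<^esub> y"
    interpret snd: group_hom W Q snd using snd_hom by unfold_locales
    have z: "?z \<in> E \<inter> wreath_base A Q"
      using xy W by (simp add: wreath_base_def kernel_def snd_wreath_closed)
    \<comment> \<open>Neither \<open>x\<close> nor \<open>y\<close> need lie in the base, but
      \<open>?z\<close> does, so evaluation splits on this product.\<close>
    have "?z \<otimes>\<^bsub>W\<^esub> y = x" using W by (simp add: W.m_assoc)
    then have "eval_at_one Q ?z \<otimes>\<^bsub>A\<^esub> eval_at_one Q y = eval_at_one Q y"
      using eval_mult_base[of ?z y] z xy(3) by simp
    then have "eval_at_one Q ?z = \<one>\<^bsub>A\<^esub>"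
      using W by (simp add: eval_at_one_def fst_wreath_closed)
    moreover have "\<one>\<^bsub>W\<^esub> \<in> E \<inter> wreath_base A Q" "eval_at_one Q \<one>\<^bsub>W\<^esub> = \<one>\<^bsub>A\<^esub>"
      by (simp_all add: wreath_base_def kernel_def eval_at_one_def) (simp_all add: one_wreath)
    ultimately have "?z = \<one>\<^bsub>W\<^esub>"
      using z ED(4) by (metis bij_betw_inv_into_left)
    then show ?thesis using W by (metis W.inv_closed W.inv_equality W.inv_inv)
  qed
  then have "inj_on (\<lambda>x. (eval_at_one Q x, snd x)) E" by (auto intro: inj_onI)
  moreover have "(\<lambda>x. (eval_at_one Q x, snd x)) ` E \<subseteq> carrier A \<times> carrier Q"
    using E.subset fst_wreath_closed snd_wreath_closed by (fastforce simp: eval_at_one_def)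
  ultimately show ?thesis unfolding lepoll_def by blast
qed

text \<open>The associated extension of \<open>E\<close> is the preimage sought, once moved to
  \<open>'e\<close>; the size assumption of the theorem enters here.\<close>

lemma corresponding_subgroups_surj:
  assumes E: "E \<in> admissible_subgroups A Q"
    and room: "carrier A \<times> carrier Q \<lesssim> (UNIV :: 'e set)"
  obtains X :: "('a, 'e, 'q) group_ext"
  where "X \<in> group_extensions A Q" "E \<in> corresponding_subgroups A Q X"
proof -
  have "carrier (total (associated_ext A Q E)) \<lesssim> (UNIV :: 'e set)"
    using lepoll_trans[OF admissible_lepoll[OF E] room] by (simp add: associated_ext_def)
  then show ?thesis
    using ext_equiv_transport[OF associated_ext[OF E]] E that
    by (auto simp: corresponding_subgroups_def)
qed

end

section \<open>The bijection of quotients\<close>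

theorem corollary3:
  fixes A :: "('a, 'm) monoid_scheme" and Q :: "('q, 'k) monoid_scheme"
  assumes "group A" and "group Q"
    and room: "carrier A \<times> carrier Q \<lesssim> (UNIV :: 'e set)"
  shows "equiv (group_extensions A Q :: ('a, 'e, 'q) group_ext set) (ext_equiv_rel A Q)
    \<and> equiv (admissible_subgroups A Q) (base_conj_rel A Q)
    \<and> (corresponding_subgroups A Q :: ('a, 'e, 'q) group_ext \<Rightarrow> _) respects ext_equiv_rel A Q
    \<and> (\<forall>X \<in> (group_extensions A Q :: ('a, 'e, 'q) group_ext set).
           corresponding_subgroups A Q X \<in> admissible_subgroups A Q // base_conj_rel A Q)
    \<and> bij_betw (\<lambda>c. \<Union>X\<in>c. corresponding_subgroups A Q X)
           ((group_extensions A Q :: ('a, 'e, 'q) group_ext set) // ext_equiv_rel A Q)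
           (admissible_subgroups A Q // base_conj_rel A Q)"
proof -
  interpret wreath A Q using assms(1,2) by (rule wreath.intro)
  let ?X = "group_extensions A Q :: ('a, 'e, 'q) group_ext set"
  let ?R = "ext_equiv_rel A Q :: (('a, 'e, 'q) group_ext \<times> _) set"
  let ?S = "admissible_subgroups A Q // base_conj_rel A Q"
  let ?c = "corresponding_subgroups A Q :: ('a, 'e, 'q) group_ext \<Rightarrow> _"
  let ?F = "\<lambda>c. \<Union>X\<in>c. ?c X"
  have resp: "?c respects ?R"
    by (auto simp only: congruent_def ext_equiv_rel_def intro!: corresponding_subgroups_cong)
  have cS: "?c X \<in> ?S" if X: "X \<in> ?X" for X
  proof -
    obtain E where E: "E \<in> ?c X" using corresponding_subgroups_nonempty[OF X] by blast
    then have "E \<in> admissible_subgroups A Q" by (simp add: corresponding_subgroups_def)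
    then show ?thesis using corresponding_subgroups_eq_class[OF E] by (simp add: quotientI)
  qed
  \<comment> \<open>All members of a class have the same set of subgroups, so the union over the
    class is that common set.\<close>
  have F: "?F (?R `` {X}) = ?c X" if "X \<in> ?X" for X
    using UN_equiv_class[OF equiv_ext_equiv_rel resp that] .
  have "inj_on ?F (?X // ?R)"
  proof (rule inj_onI)
    fix c d assume "c \<in> ?X // ?R" "d \<in> ?X // ?R" and eq: "?F c = ?F d"
    then obtain X Y where X: "X \<in> ?X" "c = ?R `` {X}" and Y: "Y \<in> ?X" "d = ?R `` {Y}"
      by (auto elim!: quotientE)
    then have "ext_equiv A X Y"
      using eq by (simp only: F ext_equiv_iff_corresponding_subgroups_eq)
    then have "(X, Y) \<in> ?R" using X(1) Y(1) by (simp add: ext_equiv_rel_def)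
    then show "c = d" using X(2) Y(2) equiv_class_eq[OF equiv_ext_equiv_rel] by simp
  qed
  moreover have "?F ` (?X // ?R) = ?S"
  proof
    show "?F ` (?X // ?R) \<subseteq> ?S" using F cS by (auto elim!: quotientE)
    show "?S \<subseteq> ?F ` (?X // ?R)"
    proof
      fix D assume "D \<in> ?S"
      then obtain E where E: "E \<in> admissible_subgroups A Q" and D: "D = base_conj_rel A Q `` {E}"
        by (rule quotientE)
      obtain X where X: "X \<in> ?X" "E \<in> ?c X"
        using corresponding_subgroups_surj[OF E room] .
      then have "D = ?F (?R `` {X})"
        using D F corresponding_subgroups_eq_class by metis
      then show "D \<in> ?F ` (?X // ?R)" using X(1) quotientI by (intro image_eqI)
    qed
  qed
  ultimately have "bij_betw ?F (?X // ?R) ?S" by (simp add: bij_betw_def)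
  then show ?thesis using equiv_ext_equiv_rel equiv_base_conj_rel resp cS by blast
qed

end
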